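(* Let $p\in\mathbb{N}$, and let $\{d_n\}_{n=1}^{\infty}\in \ell_2\setminus \ell_1$ be a sequence of positive numbers generated by a function $d$, i.e. $d_n=d(n)$ for integers $n>p$, where $d$ is a real function defined and twice continuously differentiable on the interval $(p,\infty)$. Suppose that: (1) $\dfrac{d_{n+1}}{d_n}=1+O(d_n)$; (2) for some integer $m>p$, $d'(n)\neq 0$ for all integers $n\ge m+1$ and $$\sup_{n\ge m+1,\ \zeta,\eta\in[-1,2]}\frac{|d'(n+\zeta)|}{|d'(n+\eta)|}<\infty;$$ (3) for some integer $m>p$, $d''(n)\neq 0$ for all integers $n\ge m+1$ and $$\sup_{n\ge m+1,\ \zeta,\eta\in[-1,2]}\frac{|d''(n+\zeta)|}{|d''(n+\eta)|}<\infty;$$ (4) $\dfrac{d''(n)}{d'(n)}=O(d_n)$. Let $r_0=1$, $r_n=\sqrt{d_n+d_{n+1}}$ for $n\ge 1$, and $$F(n)=\frac{1}{d_{n}}\Bigl(\frac{r_n}{r_{n-1}}-1\Bigr)+\frac{1}{d_{n+1}}\Bigl(\frac{r_n}{r_{n+1}}-1\Bigr)\qquad(n\in\mathbb{N}).$$ Then $F(n)=O(d_n)$.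
   Context: $\mathbb{N}=\{1,2,\dots\}$. $\ell_1$ and $\ell_2$ are the spaces of absolutely summable and square-summable sequences. For a positive sequence $(b_n)$, the notation $a_n=O(b_n)$ means that there is a constant $K>0$ with $|a_n|\le K b_n$ for all sufficiently large $n$, and $a_n=c_n+O(b_n)$ means $a_n-c_n=O(b_n)$. In the suprema $n$ ranges over integers and $\zeta,\eta$ over reals in $[-1,2]$; finiteness of such a supremum is understood to include that all the denominators are nonzero. *)

theory Defs
  imports "HOL-Analysis.Analysis" "HOL-Library.Landau_Symbols"
begin

(* Sequences indexed by {1, 2, ...} are functions on nat whose value at 0 is ignored. *)

definition ell1 :: "(nat \<Rightarrow> real) set" where
  "ell1 = {a. summable (\<lambda>n. \<bar>a (Suc n)\<bar>)}"

definition ell2 :: "(nat \<Rightarrow> real) set" where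
  "ell2 = {a. summable (\<lambda>n. (a (Suc n))\<^sup>2)}"

(* Intended for open S only: deriv at a point is the two-sided derivative, so it
   depends on the values of f near that point, and not only on those inside S. *)
definition twice_continuously_differentiable_on :: "(real \<Rightarrow> real) \<Rightarrow> real set \<Rightarrow> bool" where
  "twice_continuously_differentiable_on f S \<longleftrightarrow>
     (\<forall>x\<in>S. f differentiable (at x)) \<and>
     (\<forall>x\<in>S. deriv f differentiable (at x)) \<and>
     continuous_on S (deriv (deriv f))"

(* The supremum over n \<ge> m + 1 and z, w in [-1, 2] of |g (n + z)| / |g (n + w)| is finite.
   The nonvanishing of the denominators is explicit because x / 0 = 0. *)
definition finite_ratio_sup :: "(real \<Rightarrow> real) \<Rightarrow> nat \<Rightarrow> bool" where
  "finite_ratio_sup g m \<longleftrightarrow>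
     (\<forall>n\<ge>m + 1. \<forall>w\<in>{-1..2}. g (real n + w) \<noteq> 0) \<and>
     bdd_above {\<bar>g (real n + z)\<bar> / \<bar>g (real n + w)\<bar> | (n::nat) (z::real) (w::real).
       n \<ge> m + 1 \<and> z \<in> {-1..2} \<and> w \<in> {-1..2}}"

definition r_seq :: "(nat \<Rightarrow> real) \<Rightarrow> nat \<Rightarrow> real" where
  "r_seq d n = (if n = 0 then 1 else sqrt (d n + d (n + 1)))"

definition F_seq :: "(nat \<Rightarrow> real) \<Rightarrow> nat \<Rightarrow> real" where
  "F_seq d n =
     1 / d n * (r_seq d n / r_seq d (n - 1) - 1) +
     1 / d (n + 1) * (r_seq d n / r_seq d (n + 1) - 1)"

end

theory Submission
  imports Defs
begin

text \<open>
  Write \<open>a, b, c, e\<close> for the values of \<open>d\<close> at \<open>n - 1, n, n + 1, n + 2\<close>. The ratio condition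
  \<open>c / b = 1 + O(b)\<close> together with \<open>d\<^sub>n \<longlongrightarrow> 0\<close>, which follows from square summability, says that
  these four numbers are comparable and differ from each other by \<open>O(b\<^sup>2)\<close>. The two quotients
  of square roots in \<open>F(n)\<close> are \<open>sqrt (1 + t)\<close> with \<open>t = (c - a) / (a + b)\<close> and
  \<open>t = (b - e) / (c + e)\<close>, both \<open>O(b)\<close>. Replacing each of them by \<open>1 + t / 2\<close> changes \<open>F(n)\<close>
  by \<open>O(b)\<close> only, and so does replacing the resulting denominators \<open>b (a + b)\<close> and \<open>c (c + e)\<close>
  by \<open>2 b\<^sup>2\<close>. What remains is \<open>(c - a + b - e) / (4 b\<^sup>2)\<close>. Here the first differences cancel:
  the numerator is minus the sum of the two consecutive second differences \<open>a - 2 b + c\<close> and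
  \<open>b - 2 c + e\<close>. This elementary part is \<open>sqrt_ratio_sum_bound\<close>; it reduces the claim to showing
  that second differences are \<open>O(b\<^sup>3)\<close>.

  A second difference equals \<open>d''\<close> at a nearby point (\<open>second_difference_mvt\<close>), hence it
  is at most a constant times \<open>\<bar>d''(n)\<bar>\<close> because the nearby values of \<open>d''\<close> are comparable,
  and therefore \<open>O(b \<bar>d'(n)\<bar>)\<close> by the assumption on \<open>d'' / d'\<close>. Finally \<open>d'(n) = O(b\<^sup>2)\<close>,
  because nearby values of \<open>d'\<close> are comparable as well and one of them is \<open>c - b\<close>, by the mean
  value theorem.
\<close>

section \<open>The elementary estimate\<close>

text \<open>The remainder is exactly \<open>-t\<^sup>2 / (2 (1 + sqrt (1 + t))\<^sup>2)\<close>; this is why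
  the bound needs no smallness of \<open>t\<close>.\<close>

lemma sqrt_one_plus_linear_bound:
  fixes t :: real
  assumes "t \<ge> -1"
  shows "\<bar>sqrt (1 + t) - 1 - t / 2\<bar> \<le> t\<^sup>2 / 2"
proof -
  define s where "s = sqrt (1 + t)"
  have s: "s \<ge> 0" "t = s\<^sup>2 - 1"
    using assms by (auto simp: s_def)
  have "s - 1 - t / 2 = - ((s - 1)\<^sup>2 / 2)"
    unfolding s(2) by (simp add: power2_eq_square field_simps)
  then have "\<bar>s - 1 - t / 2\<bar> = (s - 1)\<^sup>2 / 2"
    by (simp only: abs_minus_cancel) simp
  also have "\<dots> \<le> (s - 1)\<^sup>2 * (s + 1)\<^sup>2 / 2"
    using mult_left_mono[of 1 "(s + 1)\<^sup>2" "(s - 1)\<^sup>2"] s(1) by simp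
  also have "(s - 1)\<^sup>2 * (s + 1)\<^sup>2 = t\<^sup>2"
    unfolding s(2) by algebra
  finally show ?thesis by (simp add: s_def)
qed

lemma sqrt_ratio_bound:
  fixes x y q M :: real
  assumes "x > 0" "y > 0" "q > 0"
    and "\<bar>x - y\<bar> / y \<le> M"
  shows "\<bar>1 / q * (sqrt x / sqrt y - 1) - (x - y) / (2 * (q * y))\<bar> \<le> M\<^sup>2 / (2 * q)"
proof -
  define t where "t = (x - y) / y"
  have xy: "1 + t = x / y" using assms by (simp add: t_def field_simps)
  have "0 < x / y" using assms by simp
  then have "t \<ge> -1" using xy by linarith
  have "\<bar>t\<bar> \<le> M" using assms by (simp add: t_def)
  then have "t\<^sup>2 \<le> M\<^sup>2" by (metis abs_ge_zero power2_abs power_mono)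
  have "\<bar>sqrt x / sqrt y - 1 - t / 2\<bar> \<le> M\<^sup>2 / 2"
    using sqrt_one_plus_linear_bound[OF \<open>t \<ge> -1\<close>] \<open>t\<^sup>2 \<le> M\<^sup>2\<close>
    unfolding xy real_sqrt_divide by linarith
  then have "\<bar>sqrt x / sqrt y - 1 - t / 2\<bar> / q \<le> M\<^sup>2 / 2 / q"
    using assms by (intro divide_right_mono) auto
  moreover have "1 / q * (sqrt x / sqrt y - 1) - (x - y) / (2 * (q * y))
      = (sqrt x / sqrt y - 1 - t / 2) / q"
    by (simp add: t_def diff_divide_distrib)
  ultimately show ?thesis using assms by (simp add: abs_divide)
qed

text \<open>The difference of the two fractions is \<open>X (2 b\<^sup>2 - q) / (4 b\<^sup>2 q)\<close>: a denominator that
  is correct to leading order may be exchanged, and the relative error of \<open>q\<close> against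
  \<open>2 b\<^sup>2\<close> is the relative error of the result.\<close>

lemma denominator_replacement_bound:
  fixes X q q0 b M E :: real
  assumes "b > 0" "q0 > 0" "q0 \<le> q"
    and "\<bar>X\<bar> \<le> M" and "\<bar>2 * b\<^sup>2 - q\<bar> \<le> E"
  shows "\<bar>X / (2 * q) - X / (4 * b\<^sup>2)\<bar> \<le> (M * E) / (4 * b\<^sup>2 * q0)"
proof -
  have "q > 0" using assms by linarith
  then have "X / (2 * q) - X / (4 * b\<^sup>2) = (X * (2 * b\<^sup>2 - q)) / (4 * b\<^sup>2 * q)"
    using assms(1) by (simp add: field_simps)
  also have "\<bar>\<dots>\<bar> = (\<bar>X\<bar> * \<bar>2 * b\<^sup>2 - q\<bar>) / (4 * b\<^sup>2 * q)"
    using \<open>q > 0\<close> by (simp add: abs_divide abs_mult)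
  also have "\<dots> \<le> (M * E) / (4 * b\<^sup>2 * q0)"
  proof (intro frac_le)
    show "\<bar>X\<bar> * \<bar>2 * b\<^sup>2 - q\<bar> \<le> M * E" "0 \<le> M * E"
      using assms(4,5) by (auto intro!: mult_mono mult_nonneg_nonneg)
  qed (use assms in auto)
  finally show ?thesis .
qed

text \<open>The bounds on first differences alone would only give \<open>O(1)\<close>, the size of each summand;
  the gain of a factor \<open>b\<close> comes from the cancellation that the hypothesis on \<open>a - b - c + e\<close>
  expresses. In the constant, \<open>31 = 2 + 8 + 1 + 20\<close>: the first two come from linearising the
  square roots, the others from unifying the denominators.\<close>

lemma sqrt_ratio_sum_bound:
  fixes a b c e K L :: real
  assumes pos: "a > 0" "b > 0"
    and c: "b / 4 \<le> c" "c \<le> 4 * b" and e: "b / 4 \<le> e"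
    and ab: "\<bar>a - b\<bar> \<le> K * b\<^sup>2" and cb: "\<bar>c - b\<bar> \<le> K * b\<^sup>2" and eb: "\<bar>e - b\<bar> \<le> K * b\<^sup>2"
    and L: "\<bar>a - b - c + e\<bar> \<le> L * b ^ 3"
  shows "\<bar>1 / b * (sqrt (b + c) / sqrt (a + b) - 1) +
          1 / c * (sqrt (b + c) / sqrt (c + e) - 1)\<bar> \<le> (31 * K\<^sup>2 + L) * b"
proof -
  have "K * b\<^sup>2 \<ge> 0" using ab by linarith
  then have "K \<ge> 0" using pos by (simp add: zero_le_mult_iff)
  have c0: "c > 0" and e0: "e > 0" using c e pos by auto
  have t: "\<bar>b + c - (a + b)\<bar> / (a + b) \<le> 2 * K * b"
  proof -
    have "\<bar>b + c - (a + b)\<bar> / (a + b) \<le> (2 * K * b\<^sup>2) / b"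
      using ab cb pos by (intro frac_le) auto
    then show ?thesis using pos by (simp add: power2_eq_square)
  qed
  have v: "\<bar>b + c - (c + e)\<bar> / (c + e) \<le> 2 * K * b"
  proof -
    have "\<bar>b + c - (c + e)\<bar> / (c + e) \<le> (K * b\<^sup>2) / (b / 2)"
      using eb c e pos by (intro frac_le) auto
    then show ?thesis using pos by (simp add: power2_eq_square)
  qed
  have 1: "\<bar>1 / b * (sqrt (b + c) / sqrt (a + b) - 1) - (c - a) / (2 * (b * (a + b)))\<bar> \<le> 2 * K\<^sup>2 * b"
    using sqrt_ratio_bound[OF _ _ pos(2) t] pos c0 by (simp add: power2_eq_square)
  have "(2 * K * b)\<^sup>2 / (2 * c) \<le> (2 * K * b)\<^sup>2 / (b / 2)"
    using c pos by (intro frac_le) auto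
  also have "\<dots> = 8 * K\<^sup>2 * b"
    using pos by (simp add: power2_eq_square)
  finally have 2: "\<bar>1 / c * (sqrt (b + c) / sqrt (c + e) - 1) - (b - e) / (2 * (c * (c + e)))\<bar> \<le> 8 * K\<^sup>2 * b"
    using sqrt_ratio_bound[OF _ _ c0 v] pos c0 e0 by simp
  \<comment> \<open>Replacing both denominators by the same quantity \<open>4 b\<^sup>2\<close>.\<close>
  have 3: "\<bar>(c - a) / (2 * (b * (a + b))) - (c - a) / (4 * b\<^sup>2)\<bar> \<le> K\<^sup>2 * b"
  proof -
    have "2 * b\<^sup>2 - b * (a + b) = b * (b - a)" by algebra
    moreover have "b * \<bar>b - a\<bar> \<le> b * (K * b\<^sup>2)"
      using ab pos by (intro mult_left_mono) auto
    ultimately have "\<bar>2 * b\<^sup>2 - b * (a + b)\<bar> \<le> K * b ^ 3"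
      using pos by (simp add: abs_mult power2_eq_square power3_eq_cube mult_ac)
    moreover have "\<bar>c - a\<bar> \<le> 2 * K * b\<^sup>2" using ab cb by linarith
    moreover have "b\<^sup>2 \<le> b * (a + b)" using pos by (simp add: power2_eq_square)
    ultimately have "\<bar>(c - a) / (2 * (b * (a + b))) - (c - a) / (4 * b\<^sup>2)\<bar>
        \<le> ((2 * K * b\<^sup>2) * (K * b ^ 3)) / (4 * b\<^sup>2 * b\<^sup>2)"
      using pos by (intro denominator_replacement_bound) auto
    also have "\<dots> = K\<^sup>2 * b / 2"
      using pos by (simp add: power2_eq_square power3_eq_cube)
    also have "\<dots> \<le> K\<^sup>2 * b" using pos by simp
    finally show ?thesis .
  qed
  have 4: "\<bar>(b - e) / (2 * (c * (c + e))) - (b - e) / (4 * b\<^sup>2)\<bar> \<le> 20 * K\<^sup>2 * b"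
  proof -
    have "2 * b\<^sup>2 - c * (c + e) = (b - c) * (b + c) + b * (b - c) + c * (b - e)" by algebra
    moreover have "\<bar>(b - c) * (b + c)\<bar> \<le> (K * b\<^sup>2) * (5 * b)"
      unfolding abs_mult using cb c c0 pos \<open>K * b\<^sup>2 \<ge> 0\<close> by (intro mult_mono) auto
    moreover have "\<bar>b * (b - c)\<bar> \<le> b * (K * b\<^sup>2)"
      unfolding abs_mult using cb pos by (intro mult_mono) auto
    moreover have "\<bar>c * (b - e)\<bar> \<le> (4 * b) * (K * b\<^sup>2)"
      unfolding abs_mult using eb c c0 pos by (intro mult_mono) auto
    moreover have "(K * b\<^sup>2) * (5 * b) + b * (K * b\<^sup>2) + (4 * b) * (K * b\<^sup>2) = 10 * K * b ^ 3"
      by algebra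
    ultimately have "\<bar>2 * b\<^sup>2 - c * (c + e)\<bar> \<le> 10 * K * b ^ 3" by linarith
    moreover have "\<bar>b - e\<bar> \<le> K * b\<^sup>2" using eb by linarith
    moreover have "(b / 4) * (b / 2) \<le> c * (c + e)"
      using c e pos c0 by (intro mult_mono) auto
    ultimately have "\<bar>(b - e) / (2 * (c * (c + e))) - (b - e) / (4 * b\<^sup>2)\<bar>
        \<le> ((K * b\<^sup>2) * (10 * K * b ^ 3)) / (4 * b\<^sup>2 * ((b / 4) * (b / 2)))"
      using pos by (intro denominator_replacement_bound) auto
    also have "\<dots> = 20 * K\<^sup>2 * b"
      using pos by (simp add: power2_eq_square power3_eq_cube)
    finally show ?thesis .
  qed
  have 5: "\<bar>(c - a) / (4 * b\<^sup>2) + (b - e) / (4 * b\<^sup>2)\<bar> \<le> L * b"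
  proof -
    have "(c - a) / (4 * b\<^sup>2) + (b - e) / (4 * b\<^sup>2) = - (a - b - c + e) / (4 * b\<^sup>2)"
      by (simp add: add_divide_distrib[symmetric])
    then have "\<bar>(c - a) / (4 * b\<^sup>2) + (b - e) / (4 * b\<^sup>2)\<bar> = \<bar>a - b - c + e\<bar> / (4 * b\<^sup>2)"
      by (simp only: abs_divide abs_minus_cancel) simp
    also have "\<dots> \<le> L * b ^ 3 / (4 * b\<^sup>2)"
      using L by (intro divide_right_mono) auto
    also have "\<dots> = L * b / 4"
      using pos by (simp add: power2_eq_square power3_eq_cube)
    finally have *: "\<bar>(c - a) / (4 * b\<^sup>2) + (b - e) / (4 * b\<^sup>2)\<bar> \<le> L * b / 4" .
    then have "L * b \<ge> 0" by linarith
    with * show ?thesis by linarith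
  qed
  have "K\<^sup>2 * b \<ge> 0" using pos by simp
  moreover have "(31 * K\<^sup>2 + L) * b = 31 * (K\<^sup>2 * b) + L * b" by algebra
  ultimately show ?thesis using 1 2 3 4 5 unfolding mult.assoc by linarith
qed

section \<open>Derivatives and finite differences\<close>

text \<open>Apply the mean value theorem to the first difference \<open>t \<mapsto> f (t + 1) - f t\<close>,
  and then to \<open>f'\<close>.\<close>

lemma second_difference_mvt:
  fixes f f' f'' :: "real \<Rightarrow> real"
  assumes f': "\<And>t. x \<le> t \<Longrightarrow> t \<le> x + 2 \<Longrightarrow> (f has_real_derivative f' t) (at t)"
    and f'': "\<And>t. x \<le> t \<Longrightarrow> t \<le> x + 2 \<Longrightarrow> (f' has_real_derivative f'' t) (at t)"
  obtains \<xi> where "x \<le> \<xi>" "\<xi> \<le> x + 2" "f (x + 2) - 2 * f (x + 1) + f x = f'' \<xi>"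
proof -
  have "((\<lambda>t. f (t + 1) - f t) has_real_derivative f' (t + 1) - f' t) (at t)"
    if "x \<le> t" "t \<le> x + 1" for t
    using that by (intro DERIV_diff iffD1[OF DERIV_shift] f') auto
  then obtain t where t: "x < t" "t < x + 1"
    "(f (x + 1 + 1) - f (x + 1)) - (f (x + 1) - f x) = (x + 1 - x) * (f' (t + 1) - f' t)"
    using MVT2[of x "x + 1" "\<lambda>t. f (t + 1) - f t" "\<lambda>t. f' (t + 1) - f' t"] by auto
  obtain \<xi> where "t < \<xi>" "\<xi> < t + 1" "f' (t + 1) - f' t = (t + 1 - t) * f'' \<xi>"
    using MVT2[of t "t + 1" f' f''] f'' t by force
  with t show ?thesis
    by (intro that[of \<xi>]) (auto simp: add.assoc)
qed

text \<open>Multiplying out the quotient turns the supremum condition into a comparison of any two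
  nearby values of \<open>g\<close> that can be chained with other estimates.\<close>

lemma finite_ratio_supE:
  assumes "finite_ratio_sup g m"
  obtains B where "B \<ge> 0"
    "\<And>n z w. \<lbrakk>n \<ge> m + 1; z \<in> {-1..2}; w \<in> {-1..2}\<rbrakk>
       \<Longrightarrow> \<bar>g (real n + z)\<bar> \<le> B * \<bar>g (real n + w)\<bar>"
proof -
  obtain B where B: "\<bar>g (real n + z)\<bar> / \<bar>g (real n + w)\<bar> \<le> B"
    if "n \<ge> m + 1" "z \<in> {-1..2}" "w \<in> {-1..2}" for n z w
    using assms unfolding finite_ratio_sup_def bdd_above_def by blast
  show ?thesis
  proof (rule that[of "max B 0"])
    fix n z w assume nzw: "n \<ge> m + 1" "z \<in> {-1..2::real}" "w \<in> {-1..2::real}"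
    have "\<bar>g (real n + w)\<bar> > 0"
      using assms nzw by (auto simp: finite_ratio_sup_def)
    with B[OF nzw] show "\<bar>g (real n + z)\<bar> \<le> max B 0 * \<bar>g (real n + w)\<bar>"
      by (simp add: pos_divide_le_eq[symmetric] del: abs_divide)
  qed simp
qed

section \<open>The asymptotic statement\<close>

lemma ell2_tendsto_zero:
  assumes "a \<in> ell2"
  shows "a \<longlonglongrightarrow> 0"
proof -
  have "(\<lambda>n. (a (Suc n))\<^sup>2) \<longlonglongrightarrow> 0"
    by (rule summable_LIMSEQ_zero) (use assms in \<open>simp add: ell2_def\<close>)
  then have "(\<lambda>n. a (Suc n)) \<longlonglongrightarrow> 0"
    by simp
  then show ?thesis by (simp add: filterlim_sequentially_Suc)
qed

theorem proposition5:
  fixes p :: nat and d :: "nat \<Rightarrow> real" and df :: "real \<Rightarrow> real"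
  assumes "p \<ge> 1"
    and "d \<in> ell2 - ell1"
    and "\<And>n. n \<ge> 1 \<Longrightarrow> d n > 0"
    and "\<And>n. n > p \<Longrightarrow> d n = df (real n)"
    and "twice_continuously_differentiable_on df {real p<..}"
    and "(\<lambda>n. d (n + 1) / d n - 1) \<in> O(d)"
    and "\<exists>m>p. (\<forall>n\<ge>m + 1. deriv df (real n) \<noteq> 0) \<and> finite_ratio_sup (deriv df) m"
    and "\<exists>m>p. (\<forall>n\<ge>m + 1. deriv (deriv df) (real n) \<noteq> 0) \<and> finite_ratio_sup (deriv (deriv df)) m"
    and "(\<lambda>n. deriv (deriv df) (real n) / deriv df (real n)) \<in> O(d)"
  shows "F_seq d \<in> O(d)"
proof -
  note pos = assms(3) and d_df = assms(4)
  have D1: "(df has_real_derivative deriv df t) (at t)"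
    and D2: "(deriv df has_real_derivative deriv (deriv df) t) (at t)" if "t > real p" for t
    using assms(5) that
    by (auto simp: twice_continuously_differentiable_on_def DERIV_deriv_iff_real_differentiable)
  obtain m1 where m1: "\<And>n. n \<ge> m1 + 1 \<Longrightarrow> deriv df (real n) \<noteq> 0"
    and "finite_ratio_sup (deriv df) m1"
    using assms(7) by blast
  then obtain B1 where B1: "B1 \<ge> 0" "\<And>n z w. \<lbrakk>n \<ge> m1 + 1; z \<in> {-1..2}; w \<in> {-1..2}\<rbrakk>
      \<Longrightarrow> \<bar>deriv df (real n + z)\<bar> \<le> B1 * \<bar>deriv df (real n + w)\<bar>"
    by (elim finite_ratio_supE) blast
  obtain m2 where "finite_ratio_sup (deriv (deriv df)) m2"
    using assms(8) by blast
  then obtain B2 where B2: "B2 \<ge> 0" "\<And>n z w. \<lbrakk>n \<ge> m2 + 1; z \<in> {-1..2}; w \<in> {-1..2}\<rbrakk>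
      \<Longrightarrow> \<bar>deriv (deriv df) (real n + z)\<bar> \<le> B2 * \<bar>deriv (deriv df) (real n + w)\<bar>"
    by (elim finite_ratio_supE) blast
  obtain C where C: "C > 0" "\<forall>\<^sub>F n in sequentially. \<bar>d (n + 1) / d n - 1\<bar> \<le> C * \<bar>d n\<bar>"
    using landau_o.bigE[OF assms(6)] unfolding real_norm_def by blast
  obtain A where A: "A > 0"
    "\<forall>\<^sub>F n in sequentially. \<bar>deriv (deriv df) (real n) / deriv df (real n)\<bar> \<le> A * \<bar>d n\<bar>"
    using landau_o.bigE[OF assms(9)] unfolding real_norm_def by blast
  have "d \<longlonglongrightarrow> 0"
    using assms(2) by (auto intro: ell2_tendsto_zero)
  then have "\<forall>\<^sub>F n in sequentially. d n < 1 / (2 * C)"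
    using C(1) by (intro order_tendstoD) auto
  with C(2) A(2) have "\<forall>\<^sub>F n in sequentially. \<bar>d (n + 1) / d n - 1\<bar> \<le> C * \<bar>d n\<bar> \<and>
      \<bar>deriv (deriv df) (real n) / deriv df (real n)\<bar> \<le> A * \<bar>d n\<bar> \<and> d n < 1 / (2 * C)"
    by eventually_elim auto
  then obtain N where N: "\<And>n. n \<ge> N \<Longrightarrow> \<bar>d (n + 1) / d n - 1\<bar> \<le> C * \<bar>d n\<bar>"
    "\<And>n. n \<ge> N \<Longrightarrow> \<bar>deriv (deriv df) (real n) / deriv df (real n)\<bar> \<le> A * \<bar>d n\<bar>"
    "\<And>n. n \<ge> N \<Longrightarrow> d n < 1 / (2 * C)"
    unfolding eventually_sequentially by blast
  \<comment> \<open>Once \<open>C d\<^sub>n \<le> 1 / 2\<close>, consecutive terms are within a factor 2 of each other; this is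
    where \<open>d\<^sub>n \<longlongrightarrow> 0\<close> enters.\<close>
  have diff: "\<bar>d (n + 1) - d n\<bar> \<le> C * (d n)\<^sup>2" and half: "d n \<le> 2 * d (n + 1)" "d (n + 1) \<le> 2 * d n"
    if "n \<ge> max N 1" for n
  proof -
    have dn: "d n > 0" using pos that by auto
    have "d (n + 1) - d n = (d (n + 1) / d n - 1) * d n"
      using dn by (simp add: field_simps)
    then have "\<bar>d (n + 1) - d n\<bar> = \<bar>d (n + 1) / d n - 1\<bar> * d n"
      using dn by (simp only: abs_mult abs_of_pos)
    also have "\<dots> \<le> (C * d n) * d n"
      using N(1)[of n] that dn by (intro mult_right_mono) auto
    finally show *: "\<bar>d (n + 1) - d n\<bar> \<le> C * (d n)\<^sup>2" by (simp add: power2_eq_square)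
    have "C * d n \<le> 1 / 2"
      using N(3)[of n] that C(1) by (simp add: field_simps)
    then have "C * (d n)\<^sup>2 \<le> d n / 2"
      using mult_right_mono[of "C * d n" "1 / 2" "d n"] dn by (simp add: power2_eq_square)
    then show "d n \<le> 2 * d (n + 1)" "d (n + 1) \<le> 2 * d n" using * dn by linarith+
  qed
  define L where "L = 2 * (B2 * (A * (B1 * C)))"
  have main: "\<bar>F_seq d n\<bar> \<le> (31 * (5 * C)\<^sup>2 + L) * \<bar>d n\<bar>" if n: "n \<ge> N + p + m1 + m2 + 2" for n
  proof -
    \<comment> \<open>The four points are \<open>n - 1\<close> to \<open>n + 2\<close>, exactly the range in which the values
      of \<open>d'\<close> and \<open>d''\<close> are compared with those at \<open>n\<close>.\<close>
    define k where "k = n - 1"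
    define a b c e where "a = d k" "b = d n" "c = d (n + 1)" "e = d (n + 2)"
    note abce = this
    have k: "k + 1 = n" "k \<ge> N + p + m1 + m2 + 1" using n by (auto simp: k_def)
    have p4: "a > 0" "b > 0" "c > 0" "e > 0"
      using pos n k by (auto simp: abce)
    have ab: "\<bar>b - a\<bar> \<le> C * a\<^sup>2" "a \<le> 2 * b" "b \<le> 2 * a"
      using diff[of k] half[of k] k by (auto simp: abce)
    have bc: "\<bar>c - b\<bar> \<le> C * b\<^sup>2" "b \<le> 2 * c" "c \<le> 2 * b"
      using diff[of n] half[of n] n by (auto simp: abce)
    have ce: "\<bar>e - c\<bar> \<le> C * c\<^sup>2" "c \<le> 2 * e" "e \<le> 2 * c"
      using diff[of "n + 1"] half[of "n + 1"] n by (auto simp: abce)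
    \<comment> \<open>Consecutive differences are bounded by \<open>C\<close> times the square of the earlier term;
      comparability expresses all of them through \<open>b\<close>.\<close>
    have quad: "C * x\<^sup>2 \<le> 4 * (C * b\<^sup>2)" if "0 < x" "x \<le> 2 * b" for x
    proof -
      have "x\<^sup>2 \<le> (2 * b)\<^sup>2" using that by (intro power_mono) auto
      from mult_left_mono[OF this, of C] show ?thesis
        using C(1) by (simp add: power_mult_distrib)
    qed
    have "C * a\<^sup>2 \<le> 4 * (C * b\<^sup>2)" "C * c\<^sup>2 \<le> 4 * (C * b\<^sup>2)"
      using quad[of a] quad[of c] ab bc p4 by blast+
    moreover have "C * b\<^sup>2 \<ge> 0" using C(1) by simp
    ultimately have K: "\<bar>a - b\<bar> \<le> 5 * C * b\<^sup>2" "\<bar>c - b\<bar> \<le> 5 * C * b\<^sup>2" "\<bar>e - b\<bar> \<le> 5 * C * b\<^sup>2"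
      using ab(1) bc(1) ce(1) unfolding mult.assoc by linarith+
    have reals: "real n = real k + 1" "real (n + 1) = real k + 2" "real (n + 2) = real k + 3"
      by (simp_all flip: k(1))
    have vals: "a = df (real k)" "b = df (real k + 1)" "c = df (real k + 2)" "e = df (real k + 3)"
      unfolding abce using d_df[of k] d_df[of n] d_df[of "n + 1"] d_df[of "n + 2"] k n
      by (simp_all only: reals)
    \<comment> \<open>The derivative at \<open>n\<close> inherits the size \<open>O(b\<^sup>2)\<close> of a first difference.\<close>
    have "\<exists>\<xi>. real k + 1 < \<xi> \<and> \<xi> < real k + 2 \<and>
        df (real k + 2) - df (real k + 1) = (real k + 2 - (real k + 1)) * deriv df \<xi>"
      using k by (intro MVT2) (auto intro!: D1)
    then obtain \<xi> where \<xi>: "real k + 1 < \<xi>" "\<xi> < real k + 2" "c - b = deriv df \<xi>"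
      unfolding vals by auto
    have "\<bar>deriv df (real n)\<bar> \<le> B1 * \<bar>c - b\<bar>"
      using B1(2)[of n 0 "\<xi> - real n"] \<xi> n reals(1) by auto
    also have "\<dots> \<le> B1 * (C * b\<^sup>2)"
      using bc(1) B1(1) by (rule mult_left_mono)
    finally have d1: "\<bar>deriv df (real n)\<bar> \<le> B1 * (C * b\<^sup>2)" .
    \<comment> \<open>The second derivative gains a factor \<open>b\<close> over the first.\<close>
    have "\<bar>deriv (deriv df) (real n)\<bar> = \<bar>deriv (deriv df) (real n) / deriv df (real n)\<bar> * \<bar>deriv df (real n)\<bar>"
      using m1[of n] n by simp
    also have "\<dots> \<le> (A * b) * (B1 * (C * b\<^sup>2))"
      using N(2)[of n] n d1 p4 A(1) by (intro mult_mono) (auto simp: abce)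
    finally have d2: "\<bar>deriv (deriv df) (real n)\<bar> \<le> (A * b) * (B1 * (C * b\<^sup>2))" .
    have near: "\<bar>deriv (deriv df) t\<bar> \<le> L / 2 * b ^ 3" if "real k \<le> t" "t \<le> real k + 3" for t
    proof -
      have "\<bar>deriv (deriv df) t\<bar> \<le> B2 * \<bar>deriv (deriv df) (real n)\<bar>"
        using B2(2)[of n "t - real n" 0] that n reals(1) by auto
      also have "\<dots> \<le> B2 * ((A * b) * (B1 * (C * b\<^sup>2)))"
        using d2 B2(1) by (rule mult_left_mono)
      finally show ?thesis
        by (simp add: L_def power2_eq_square power3_eq_cube mult_ac)
    qed
    have kp: "real k > real p" using k(2) by simp
    obtain u where u: "real k \<le> u" "u \<le> real k + 2"
      "df (real k + 2) - 2 * df (real k + 1) + df (real k) = deriv (deriv df) u"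
      by (rule second_difference_mvt[of "real k" df "deriv df" "deriv (deriv df)"])
        (use kp in \<open>auto intro!: D1 D2\<close>)
    obtain v where v: "real k + 1 \<le> v" "v \<le> real k + 1 + 2"
      "df (real k + 1 + 2) - 2 * df (real k + 1 + 1) + df (real k + 1) = deriv (deriv df) v"
      by (rule second_difference_mvt[of "real k + 1" df "deriv df" "deriv (deriv df)"])
        (use kp in \<open>auto intro!: D1 D2\<close>)
    have "c - 2 * b + a = deriv (deriv df) u" "e - 2 * c + b = deriv (deriv df) v"
      using u(3) v(3) by (simp_all add: vals add.assoc)
    moreover have "\<bar>deriv (deriv df) u\<bar> \<le> L / 2 * b ^ 3" "\<bar>deriv (deriv df) v\<bar> \<le> L / 2 * b ^ 3"
      using near[of u] near[of v] u(1,2) v(1,2) by linarith+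
    ultimately have "\<bar>a - b - c + e\<bar> \<le> L / 2 * b ^ 3 + L / 2 * b ^ 3"
      by linarith
    then have "\<bar>a - b - c + e\<bar> \<le> L * b ^ 3" by simp
    then have "\<bar>1 / b * (sqrt (b + c) / sqrt (a + b) - 1) +
        1 / c * (sqrt (b + c) / sqrt (c + e) - 1)\<bar> \<le> (31 * (5 * C)\<^sup>2 + L) * b"
      by (intro sqrt_ratio_sum_bound) (use p4 bc ce K in auto)
    moreover have "F_seq d n = 1 / b * (sqrt (b + c) / sqrt (a + b) - 1) +
        1 / c * (sqrt (b + c) / sqrt (c + e) - 1)"
      using n k by (simp add: F_seq_def r_seq_def abce k_def)
    ultimately show ?thesis using p4 by (simp add: abce)
  qed
  have "\<forall>\<^sub>F n in sequentially. norm (F_seq d n) \<le> (31 * (5 * C)\<^sup>2 + L) * norm (d n)"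
    using main unfolding eventually_sequentially real_norm_def by blast
  moreover have "31 * (5 * C)\<^sup>2 + L > 0"
    using C(1) A(1) B1(1) B2(1) by (auto simp: L_def intro!: add_pos_nonneg)
  ultimately show ?thesis by (intro landau_o.bigI)
qed

end
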